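(* Let $n$ be a positive integer divisible by $6$ and let $b = n/6$. Then every graph on $n$ vertices with at least $n^2/4$ edges and book number at most $b$ which is not the balanced complete bipartite graph has at least $b^2(n-4b)$ triangles, with equality if and only if the graph is (isomorphic to) $S_{b,n}$.
   Context: The book number $b(G)$ of a graph $G$ is the maximum, over all edges $uv$ of $G$, of the number of triangles containing the edge $uv$ (equivalently, the number of common neighbours of $u$ and $v$). The balanced complete bipartite graph on $n$ vertices is the complete bipartite graph with parts of sizes $\lfloor n/2\rfloor$ and $\lceil n/2\rceil$. For nonnegative integers $b \le n/4$, $S_{b,n}$ is the graph on $n$ vertices whose vertex set is partitioned into six parts $U_1,U_2,U_3,V_1,V_2,V_3$ with $|U_1|=|U_2|=|V_1|=|V_2|=b$, $|U_3|=\lfloor (n-4b)/2\rfloor$, $|V_3|=\lceil (n-4b)/2\rceil$, where $U_i$ is complete to $U_j$ for $i\neq j$, $V_i$ is complete to $V_j$ for $i \neq j$, $U_i$ is complete to $V_i$ for each $i$, and there are no other edges. (For $b=n/6$ all six parts have size $n/6$ and $b^2(n-4b)=n^3/108$.) *)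

theory Defs
  imports Complex_Main
begin

type_synonym 'a ugraph = "'a set \<times> 'a set set"

abbreviation verts :: "'a ugraph \<Rightarrow> 'a set" where
  "verts \<equiv> fst"

abbreviation edges :: "'a ugraph \<Rightarrow> 'a set set" where
  "edges \<equiv> snd"

definition simple_graph :: "'a ugraph \<Rightarrow> bool" where
  "simple_graph G \<longleftrightarrow>
     finite (verts G) \<and> (\<forall>e\<in>edges G. e \<subseteq> verts G \<and> card e = 2)"

definition graph_iso :: "'a ugraph \<Rightarrow> 'b ugraph \<Rightarrow> bool" where
  "graph_iso G H \<longleftrightarrow>
     (\<exists>f. bij_betw f (verts G) (verts H) \<and>
          (\<forall>u\<in>verts G. \<forall>v\<in>verts G. {u, v} \<in> edges G \<longleftrightarrow> {f u, f v} \<in> edges H))"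

definition triangles :: "'a ugraph \<Rightarrow> 'a set set" where
  "triangles G =
     {T. T \<subseteq> verts G \<and> card T = 3 \<and> (\<forall>u\<in>T. \<forall>v\<in>T. u \<noteq> v \<longrightarrow> {u, v} \<in> edges G)}"

text \<open>The inserted 0 fixes the book number of a graph without edges; it does not
  affect the maximum otherwise.\<close>

definition book_number :: "'a ugraph \<Rightarrow> nat" where
  "book_number G = Max (insert 0 ((\<lambda>e. card {T \<in> triangles G. e \<subseteq> T}) ` edges G))"

text \<open>Vertices are pairs of a side and an index; the side \<^term>\<open>False\<close> has
  \<open>\<lfloor>n/2\<rfloor>\<close> vertices and the side \<^term>\<open>True\<close> has \<open>\<lceil>n/2\<rceil>\<close>.\<close>

definition balanced_complete_bipartite :: "nat \<Rightarrow> (bool \<times> nat) ugraph" where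
  "balanced_complete_bipartite n =
     (let X = {False} \<times> {..<n div 2}; Y = {True} \<times> {..<(n + 1) div 2}
      in (X \<union> Y, {{x, y} | x y. x \<in> X \<and> y \<in> Y}))"

text \<open>A vertex of \<open>S\<^sub>b\<^sub>,\<^sub>n\<close> is a triple \<open>(s, i, k)\<close>: it is the \<open>k\<close>-th vertex of
  \<open>U\<^sub>i\<close> if \<open>s\<close> is \<^term>\<open>False\<close>, and of \<open>V\<^sub>i\<close> if \<open>s\<close> is \<^term>\<open>True\<close>. The definition is meant
  for \<open>4 * b \<le> n\<close>, where the subtraction on naturals is exact.\<close>

definition S_part_size :: "nat \<Rightarrow> nat \<Rightarrow> bool \<Rightarrow> nat \<Rightarrow> nat" where
  "S_part_size b n s i =
     (if i \<noteq> 3 then b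
      else if s then (n - 4 * b + 1) div 2
      else (n - 4 * b) div 2)"

definition S_adj :: "bool \<times> nat \<times> nat \<Rightarrow> bool \<times> nat \<times> nat \<Rightarrow> bool" where
  "S_adj = (\<lambda>(s, i, k) (t, j, l). (s = t \<and> i \<noteq> j) \<or> (s \<noteq> t \<and> i = j))"

definition S_graph :: "nat \<Rightarrow> nat \<Rightarrow> (bool \<times> nat \<times> nat) ugraph" where
  "S_graph b n =
     (let W = {(s, i, k). i \<in> {1..3} \<and> k < S_part_size b n s i}
      in (W, {{x, y} | x y. x \<in> W \<and> y \<in> W \<and> S_adj x y}))"

end

theory Submission
  imports Defs
begin

text \<open>
  Write \<open>d(x)\<close> for degrees and \<open>c(xy)\<close> for the number of common neighbours of \<open>x\<close> and \<open>y\<close>.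
  In every triangle \<open>xyz\<close> one has \<open>d(x) + d(y) + d(z) \<le> n + c(xy) + c(yz) + c(xz)\<close>, because
  \<open>j \<le> 1 + (j choose 2)\<close>. Summing this over all triangles, together with the sum of
  \<open>(b - c(xy)) (c(xy) - d(x) - d(y) + n) \<ge> 0\<close> over all edges, leaves no room when \<open>b = n/6\<close>
  and there are at least \<open>n\<^sup>2/4\<close> edges: the graph is \<open>n/2\<close>-regular, every edge lies in \<open>0\<close>
  or \<open>b\<close> triangles, and every vertex has one or two neighbours in each triangle.

  A vertex in no triangle has an independent neighbourhood of size \<open>n/2\<close>, which by regularity
  makes the graph balanced complete bipartite. Otherwise at least \<open>2b\<close> edges at each vertex lie in
  \<open>b\<close> triangles each, since there is no \<open>K\<^sub>4\<close>, and this gives at least \<open>2b\<^sup>3\<close> triangles.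
  In the case of equality, two vertices completing the same edge to a triangle are twins, and the
  adjacencies to one fixed triangle determine the six parts of \<open>S\<^sub>b\<^sub>,\<^sub>n\<close>.
\<close>

section \<open>Double counting over triangles\<close>

locale finite_adjacency =
  fixes V :: "'a set" and adj :: "'a \<Rightarrow> 'a \<Rightarrow> bool"
  assumes finite_V: "finite V"
    and adj_V: "adj x y \<Longrightarrow> x \<in> V"
    and adj_sym: "adj x y \<Longrightarrow> adj y x"
    and adj_irrefl: "\<not> adj x x"
begin

definition nb :: "'a \<Rightarrow> 'a set" where "nb x = {y. adj x y}"

definition codeg :: "'a \<Rightarrow> 'a \<Rightarrow> nat" where "codeg x y = card (nb x \<inter> nb y)"

lemma adj_commute: "adj x y \<longleftrightarrow> adj y x"
  using adj_sym by blast

lemma mem_nb [simp]: "y \<in> nb x \<longleftrightarrow> adj x y"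
  by (simp add: nb_def)

lemma nb_subset: "nb x \<subseteq> V"
  using adj_V adj_sym by (metis mem_nb subsetI)

lemma finite_nb [simp]: "finite (nb x)"
  using finite_subset[OF nb_subset finite_V] .

abbreviation ind :: "'a \<Rightarrow> 'a \<Rightarrow> int" where "ind x y \<equiv> of_bool (adj x y)"

lemma sum_ind: "(\<Sum>y\<in>V. ind x y) = int (card (nb x))"
proof -
  have "V \<inter> {y. adj x y} = nb x" using nb_subset by auto
  then show ?thesis using finite_V by (simp add: sum_of_bool_eq)
qed

lemma sum_ind_ind: "(\<Sum>z\<in>V. ind x z * ind y z) = int (codeg x y)"
proof -
  have "V \<inter> {z. adj x z \<and> adj y z} = nb x \<inter> nb y" using nb_subset by auto
  then show ?thesis
    using finite_V by (simp only: of_bool_conj[symmetric] sum_of_bool_eq codeg_def)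
qed

lemma codeg_commute: "codeg x y = codeg y x"
  by (simp add: codeg_def Int_commute)

text \<open>Inclusion-exclusion for the two neighbourhoods inside \<open>V\<close>; over
  \<open>int\<close> the bound stays meaningful when its right-hand side is negative.\<close>

lemma codeg_ge: "int (codeg x y) \<ge> int (card (nb x)) + int (card (nb y)) - int (card V)"
proof -
  have "card (nb x \<union> nb y) \<le> card V"
    using nb_subset by (intro card_mono finite_V) auto
  then show ?thesis
    using card_Un_Int[of "nb x" "nb y"] by (simp add: codeg_def)
qed

text \<open>A vertex with \<open>j\<close> neighbours in the triangle \<open>x y z\<close> contributes
  \<open>1 + (j choose 2) - j = (j - 1) * (j - 2) / 2\<close>.\<close>

lemma triangle_excess:
  "int (card V) + int (codeg x y) + int (codeg y z) + int (codeg x z)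
     - int (card (nb x)) - int (card (nb y)) - int (card (nb z))
   = (\<Sum>v\<in>V. of_bool (adj x v \<and> adj y v \<and> adj z v)
             + of_bool (\<not> adj x v \<and> \<not> adj y v \<and> \<not> adj z v))"
  (is "?l = ?r")
proof -
  have "?l = (\<Sum>v\<in>V. 1 + ind x v * ind y v + ind y v * ind z v + ind x v * ind z v
                 - ind x v - ind y v - ind z v)"
    by (simp add: sum.distrib sum_subtractf sum_ind_ind sum_ind)
  also have "\<dots> = ?r"
    by (intro sum.cong refl) auto
  finally show ?thesis .
qed

section \<open>Sums over ordered triangles and ordered edges\<close>

lemma sum_triple_rotate:
  fixes f :: "'a \<Rightarrow> 'a \<Rightarrow> 'a \<Rightarrow> int"
  shows "(\<Sum>x\<in>V. \<Sum>y\<in>V. \<Sum>z\<in>V. f x y z) = (\<Sum>x\<in>V. \<Sum>y\<in>V. \<Sum>z\<in>V. f y z x)"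
proof -
  have "(\<Sum>x\<in>V. \<Sum>y\<in>V. \<Sum>z\<in>V. f y z x) = (\<Sum>y\<in>V. \<Sum>x\<in>V. \<Sum>z\<in>V. f y z x)"
    by (rule sum.swap)
  also have "\<dots> = (\<Sum>y\<in>V. \<Sum>z\<in>V. \<Sum>x\<in>V. f y z x)"
    by (intro sum.cong refl sum.swap)
  finally show ?thesis by simp
qed

text \<open>The indicator of a triangle is invariant under rotation, so a weight on one edge or
  vertex of the triangle can be moved to any other.\<close>

lemma sum_triangles_rotate:
  fixes f :: "'a \<Rightarrow> 'a \<Rightarrow> 'a \<Rightarrow> int"
  shows "(\<Sum>x\<in>V. \<Sum>y\<in>V. \<Sum>z\<in>V. ind x y * ind y z * ind x z * f x y z)
       = (\<Sum>x\<in>V. \<Sum>y\<in>V. \<Sum>z\<in>V. ind x y * ind y z * ind x z * f y z x)"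
  by (subst sum_triple_rotate) (intro sum.cong refl, auto simp: adj_commute)

text \<open>Summing out \<open>z\<close> counts the triangles on the edge
  \<open>x y\<close>.\<close>

lemma sum_triangles_edge:
  fixes f :: "'a \<Rightarrow> 'a \<Rightarrow> int"
  shows "(\<Sum>x\<in>V. \<Sum>y\<in>V. \<Sum>z\<in>V. ind x y * ind y z * ind x z * f x y)
       = (\<Sum>x\<in>V. \<Sum>y\<in>V. ind x y * (int (codeg x y) * f x y))"
proof (intro sum.cong refl)
  fix x y
  have "(\<Sum>z\<in>V. ind x y * ind y z * ind x z * f x y)
      = (\<Sum>z\<in>V. ind x z * ind y z) * (ind x y * f x y)"
    by (subst sum_distrib_right) (intro sum.cong refl, simp)
  then show "(\<Sum>z\<in>V. ind x y * ind y z * ind x z * f x y)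
      = ind x y * (int (codeg x y) * f x y)"
    by (simp add: sum_ind_ind)
qed

lemma sum_edges_swap:
  fixes f :: "'a \<Rightarrow> 'a \<Rightarrow> int"
  shows "(\<Sum>x\<in>V. \<Sum>y\<in>V. ind x y * f x y) = (\<Sum>x\<in>V. \<Sum>y\<in>V. ind x y * f y x)"
  by (subst sum.swap) (intro sum.cong refl, simp add: adj_commute)

text \<open>Conclusion of the double counting of Khadzhiivanov and Nikiforov: at \<open>b = n/6\<close> all
  inequalities in it are equalities.\<close>

lemma extremal_book:
  assumes card_V: "card V = 6 * b" and "b > 0"
    and book: "\<And>x y. adj x y \<Longrightarrow> codeg x y \<le> b"
    and degsum: "(\<Sum>x\<in>V. card (nb x)) \<ge> 18 * b\<^sup>2"
  shows "x \<in> V \<Longrightarrow> card (nb x) = 3 * b"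
    and "adj x y \<Longrightarrow> codeg x y = 0 \<or> codeg x y = b"
    and "\<lbrakk>adj x y; adj y z; adj x z\<rbrakk> \<Longrightarrow> \<not> (adj x v \<and> adj y v \<and> adj z v)"
    and "\<lbrakk>adj x y; adj y z; adj x z; v \<in> V\<rbrakk> \<Longrightarrow> adj x v \<or> adj y v \<or> adj z v"
proof -
  define d where "d x = int (card (nb x))" for x
  define c where "c x y = int (codeg x y)" for x y
  define B where "B = int b"
  have B: "B > 0" using \<open>b > 0\<close> by (simp add: B_def)
  have n: "int (card V) = 6 * B" using card_V by (simp add: B_def)
  \<comment> \<open>Sums run over ordered pairs and triples, so \<open>T\<close> is six times the
    number of triangles. \<open>Q\<close> and \<open>P\<close> sum \<open>c x y\<close> and
    \<open>d x\<close> over the same ordered triangles.\<close>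
  define T where "T = (\<Sum>x\<in>V. \<Sum>y\<in>V. ind x y * c x y)"
  define Q where "Q = (\<Sum>x\<in>V. \<Sum>y\<in>V. ind x y * (c x y * c x y))"
  define P where "P = (\<Sum>x\<in>V. \<Sum>y\<in>V. ind x y * (c x y * d x))"
  define S where "S = (\<Sum>x\<in>V. \<Sum>y\<in>V. ind x y * (d x + d y - 6 * B))"
  define ex where "ex x y z = 6 * B + c x y + c y z + c x z - d x - d y - d z" for x y z
  have ex_alt: "ex x y z = (\<Sum>v\<in>V. of_bool (adj x v \<and> adj y v \<and> adj z v)
             + of_bool (\<not> adj x v \<and> \<not> adj y v \<and> \<not> adj z v))" for x y z
    unfolding ex_def c_def d_def n[symmetric] by (rule triangle_excess)
  have ex_nonneg: "ex x y z \<ge> 0" for x y z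
    unfolding ex_alt by (intro sum_nonneg) auto
  define w where "w x y z = ind x y * ind y z * ind x z" for x y z
  have w_nonneg: "w x y z \<ge> 0" for x y z by (simp add: w_def)
  have P': "(\<Sum>x\<in>V. \<Sum>y\<in>V. ind x y * (c x y * d y)) = P"
    unfolding P_def using sum_edges_swap[of "\<lambda>x y. c x y * d y"]
    by (simp add: c_def codeg_commute)
  have wT: "(\<Sum>x\<in>V. \<Sum>y\<in>V. \<Sum>z\<in>V. w x y z) = T"
    unfolding T_def c_def w_def using sum_triangles_edge[of "\<lambda>_ _. 1"] by simp
  have wQ1: "(\<Sum>x\<in>V. \<Sum>y\<in>V. \<Sum>z\<in>V. w x y z * c x y) = Q"
    unfolding Q_def c_def w_def by (rule sum_triangles_edge)
  have wQ2: "(\<Sum>x\<in>V. \<Sum>y\<in>V. \<Sum>z\<in>V. w x y z * c y z) = Q"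
    using wQ1 sum_triangles_rotate[of "\<lambda>x y z. c x y"] by (simp add: w_def)
  have wQ3: "(\<Sum>x\<in>V. \<Sum>y\<in>V. \<Sum>z\<in>V. w x y z * c x z) = Q"
    using wQ2 sum_triangles_rotate[of "\<lambda>x y z. c y z"]
    by (simp add: w_def c_def codeg_commute)
  have wP1: "(\<Sum>x\<in>V. \<Sum>y\<in>V. \<Sum>z\<in>V. w x y z * d x) = P"
    unfolding P_def c_def w_def by (rule sum_triangles_edge)
  have wP2: "(\<Sum>x\<in>V. \<Sum>y\<in>V. \<Sum>z\<in>V. w x y z * d y) = P"
    using wP1 sum_triangles_rotate[of "\<lambda>x y z. d x"] by (simp add: w_def)
  have wP3: "(\<Sum>x\<in>V. \<Sum>y\<in>V. \<Sum>z\<in>V. w x y z * d z) = P"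
    using wP2 sum_triangles_rotate[of "\<lambda>x y z. d y"] by (simp add: w_def)
  have wex: "(\<Sum>x\<in>V. \<Sum>y\<in>V. \<Sum>z\<in>V. w x y z * ex x y z) = 6 * B * T + 3 * Q - 3 * P"
  proof -
    have "(\<Sum>x\<in>V. \<Sum>y\<in>V. \<Sum>z\<in>V. w x y z * ex x y z) =
      (\<Sum>x\<in>V. \<Sum>y\<in>V. \<Sum>z\<in>V. 6 * B * w x y z + w x y z * c x y + w x y z * c y z + w x y z * c x z
         - w x y z * d x - w x y z * d y - w x y z * d z)"
      by (intro sum.cong refl) (simp add: ex_def algebra_simps)
    also have "\<dots> = 6 * B * T + Q + Q + Q - P - P - P"
      unfolding sum.distrib sum_subtractf wQ1 wQ2 wQ3 wP1 wP2 wP3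
      by (simp add: sum_distrib_left[symmetric] wT)
    finally show ?thesis by simp
  qed
  have wex_nonneg: "w x y z * ex x y z \<ge> 0" for x y z
    by (intro mult_nonneg_nonneg w_nonneg ex_nonneg)
  have ex_sum: "6 * B * T + 3 * Q - 3 * P \<ge> 0"
    unfolding wex[symmetric] by (intro sum_nonneg wex_nonneg)
  have c_le: "c x y \<le> B" if "adj x y" for x y
    using book[OF that] by (simp add: c_def B_def)
  have c_ge: "c x y \<ge> d x + d y - 6 * B" for x y
    using codeg_ge[of x y] by (simp add: c_def d_def n)
  have c_nonneg: "c x y \<ge> 0" for x y by (simp add: c_def)
  define sl where "sl x y = ind x y * (c x y * (B - c x y))" for x y
  have slack: "B * T - Q = (\<Sum>x\<in>V. \<Sum>y\<in>V. sl x y)"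
    unfolding sl_def T_def Q_def sum_distrib_left sum_subtractf[symmetric]
    by (intro sum.cong refl) (simp add: algebra_simps)
  have slack_nonneg: "sl x y \<ge> 0" for x y
    using c_le[of x y] c_nonneg[of x y] by (simp add: sl_def)
  have BTQ: "B * T - Q \<ge> 0"
    unfolding slack by (intro sum_nonneg slack_nonneg)
  \<comment> \<open>On edges both factors are nonnegative, the first by the book bound and the
    second by inclusion-exclusion.\<close>
  have "(\<Sum>x\<in>V. \<Sum>y\<in>V. ind x y * ((B - c x y) * (c x y - (d x + d y - 6 * B))))
      = B * T - Q - B * S + 2 * P - 6 * B * T"
  proof -
    have "(\<Sum>x\<in>V. \<Sum>y\<in>V. ind x y * ((B - c x y) * (c x y - (d x + d y - 6 * B)))) =
      (\<Sum>x\<in>V. \<Sum>y\<in>V. B * (ind x y * c x y) - ind x y * (c x y * c x y)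
         - B * (ind x y * (d x + d y - 6 * B))
         + ind x y * (c x y * d x) + ind x y * (c x y * d y) - 6 * B * (ind x y * c x y))"
      by (intro sum.cong refl) (simp add: algebra_simps)
    also have "\<dots> = B * T - Q - B * S + P + P - 6 * B * T"
      unfolding sum.distrib sum_subtractf P' sum_distrib_left[symmetric]
      by (simp add: T_def Q_def P_def S_def)
    finally show ?thesis by simp
  qed
  moreover have "(\<Sum>x\<in>V. \<Sum>y\<in>V. ind x y * ((B - c x y) * (c x y - (d x + d y - 6 * B)))) \<ge> 0"
    using c_le c_ge by (intro sum_nonneg) simp
  ultimately have mixed: "B * T - Q - B * S + 2 * P - 6 * B * T \<ge> 0" by simp
  \<comment> \<open>Add \<open>mixed\<close>, two thirds of \<open>ex_sum\<close>, and
    \<open>BTQ\<close>: \<open>P\<close> and \<open>Q\<close> cancel, and the coefficient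
    \<open>2 * B - n / 3\<close> of \<open>T\<close> vanishes because
    \<open>n = 6 * B\<close>.\<close>
  have BS: "B * S \<le> 0"
    using mixed ex_sum BTQ by linarith
  \<comment> \<open>Completing the square around \<open>n / 2 = 3 * B\<close>. Both summands are
    nonnegative, so \<open>S \<le> 0\<close> forces regularity.\<close>
  have S_alt: "S = 2 * (\<Sum>x\<in>V. (d x - 3 * B)\<^sup>2) + 6 * B * ((\<Sum>x\<in>V. d x) - 18 * B\<^sup>2)"
  proof -
    have row: "(\<Sum>y\<in>V. ind x y) = d x" for x by (simp add: d_def sum_ind)
    have 1: "(\<Sum>x\<in>V. \<Sum>y\<in>V. ind x y * d x) = (\<Sum>x\<in>V. d x * d x)"
      by (simp add: sum_distrib_right[symmetric] row)
    then have 2: "(\<Sum>x\<in>V. \<Sum>y\<in>V. ind x y * d y) = (\<Sum>x\<in>V. d x * d x)"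
      using sum_edges_swap[of "\<lambda>x y. d x"] by simp
    have 3: "(\<Sum>x\<in>V. \<Sum>y\<in>V. 6 * B * ind x y) = 6 * B * (\<Sum>x\<in>V. d x)"
      by (simp only: sum_distrib_left[symmetric] row)
    have "S = (\<Sum>x\<in>V. \<Sum>y\<in>V. ind x y * d x + ind x y * d y - 6 * B * ind x y)"
      unfolding S_def by (intro sum.cong refl) (simp add: algebra_simps)
    also have "\<dots> = 2 * (\<Sum>x\<in>V. d x * d x) - 6 * B * (\<Sum>x\<in>V. d x)"
      unfolding sum.distrib sum_subtractf 1 2 3 by simp
    finally have S: "S = 2 * (\<Sum>x\<in>V. d x * d x) - 6 * B * (\<Sum>x\<in>V. d x)" .
    have "(\<Sum>x\<in>V. (d x - 3 * B)\<^sup>2) = (\<Sum>x\<in>V. d x * d x - 6 * B * d x + 9 * B\<^sup>2)"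
      by (intro sum.cong refl) (simp add: power2_eq_square algebra_simps)
    also have "\<dots> = (\<Sum>x\<in>V. d x * d x) - 6 * B * (\<Sum>x\<in>V. d x) + 54 * B ^ 3"
      unfolding sum.distrib sum_subtractf sum_distrib_left[symmetric]
      by (simp add: n power2_eq_square power3_eq_cube)
    finally show ?thesis
      using S by (simp add: algebra_simps power2_eq_square power3_eq_cube)
  qed
  have dsum: "(\<Sum>x\<in>V. d x) - 18 * B\<^sup>2 \<ge> 0"
    using degsum by (simp add: d_def B_def flip: of_nat_sum of_nat_power)
  have "S \<le> 0" using BS B by (simp add: mult_le_0_iff)
  moreover have "6 * B * ((\<Sum>x\<in>V. d x) - 18 * B\<^sup>2) \<ge> 0" using dsum B by simp
  moreover have sq: "(\<Sum>x\<in>V. (d x - 3 * B)\<^sup>2) \<ge> 0" by (intro sum_nonneg) simp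
  ultimately have "(\<Sum>x\<in>V. (d x - 3 * B)\<^sup>2) = 0" and "S = 0"
    using S_alt by linarith+
  then have d: "d x = 3 * B" if "x \<in> V" for x
    using that finite_V by (simp add: sum_nonneg_eq_0_iff)
  then show "card (nb x) = 3 * b" if "x \<in> V" for x
    using that by (force simp: d_def B_def)
  \<comment> \<open>Regularity turns \<open>ex_sum\<close> into
    \<open>3 * (Q - B * T) \<ge> 0\<close>, the reverse of \<open>BTQ\<close>. Both sums of
    nonnegative terms therefore vanish, term by term.\<close>
  have "P = 3 * B * T"
    unfolding P_def T_def sum_distrib_left
    by (intro sum.cong refl) (simp add: d)
  then have "B * T - Q = 0" and "6 * B * T + 3 * Q - 3 * P = 0"
    using ex_sum BTQ by linarith+
  then have slack0: "\<forall>x\<in>V. \<forall>y\<in>V. sl x y = 0"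
    and ex0: "\<forall>x\<in>V. \<forall>y\<in>V. \<forall>z\<in>V. w x y z * ex x y z = 0"
    unfolding slack wex[symmetric] using finite_V slack_nonneg wex_nonneg
    by (simp_all add: sum_nonneg_eq_0_iff sum_nonneg del: mult_eq_0_iff)
  show "codeg x y = 0 \<or> codeg x y = b" if "adj x y" for x y
  proof -
    have "x \<in> V" "y \<in> V" using that adj_V adj_sym by blast+
    then have "sl x y = 0" using slack0 by blast
    then show ?thesis using that by (auto simp: sl_def c_def B_def)
  qed
  have ex0': "\<not> (adj x v \<and> adj y v \<and> adj z v) \<and> (adj x v \<or> adj y v \<or> adj z v)"
    if "adj x y" "adj y z" "adj x z" "v \<in> V" for x y z v
  proof -
    have "x \<in> V" "y \<in> V" "z \<in> V" using that adj_V adj_sym by blast+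
    then have "ex x y z = 0" using ex0 that by (force simp: w_def)
    then have "\<forall>v\<in>V. of_bool (adj x v \<and> adj y v \<and> adj z v)
             + of_bool (\<not> adj x v \<and> \<not> adj y v \<and> \<not> adj z v) = (0 :: int)"
      unfolding ex_alt using finite_V by (subst (asm) sum_nonneg_eq_0_iff) auto
    with \<open>v \<in> V\<close> show ?thesis by (auto split: if_splits)
  qed
  show "\<not> (adj x v \<and> adj y v \<and> adj z v)" if "adj x y" "adj y z" "adj x z" for x y z v
    using ex0'[OF that] adj_V adj_sym by blast
  show "adj x v \<or> adj y v \<or> adj z v" if "adj x y" "adj y z" "adj x z" "v \<in> V" for x y z v
    using ex0'[OF that] by blast
qed

end

section \<open>Structure in the case of equality\<close>

text \<open>The assumptions are the conclusions of \<open>extremal_book\<close>; the edge count and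
  the book bound enter the structural argument only through them.\<close>

locale book_equality = finite_adjacency +
  fixes b :: nat
  assumes b_pos: "b > 0"
    and card_V: "card V = 6 * b"
    and regular: "x \<in> V \<Longrightarrow> card (nb x) = 3 * b"
    and codeg_cases: "adj x y \<Longrightarrow> codeg x y = 0 \<or> codeg x y = b"
    and no_K4: "\<lbrakk>adj x y; adj y z; adj x z\<rbrakk> \<Longrightarrow> \<not> (adj x v \<and> adj y v \<and> adj z v)"
    and dominated:
      "\<lbrakk>adj x y; adj y z; adj x z; v \<in> V\<rbrakk> \<Longrightarrow> adj x v \<or> adj y v \<or> adj z v"
begin

text \<open>The sides are \<open>nb x\<close> and its complement, both of size \<open>3 * b\<close>.
  Independence confines the neighbourhood of a vertex of \<open>nb x\<close> to the complement, and
  regularity makes it all of it; counting again fixes the neighbourhoods on the other side.\<close>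

lemma independent_nb_bipartite:
  assumes "x \<in> V" and indep: "\<And>u v. \<lbrakk>adj x u; adj x v\<rbrakk> \<Longrightarrow> \<not> adj u v"
    and "u \<in> V" and "v \<in> V"
  shows "adj u v \<longleftrightarrow> (adj x u \<noteq> adj x v)"
proof -
  have compl: "card (V - nb x) = 3 * b"
    using card_Diff_subset[OF finite_nb nb_subset] regular[OF \<open>x \<in> V\<close>] card_V by simp
  have in_nb: "nb y = V - nb x" if "adj x y" for y
  proof (rule card_subset_eq)
    show "nb y \<subseteq> V - nb x" using indep[OF that] nb_subset by auto
    show "card (nb y) = card (V - nb x)"
      using compl regular adj_V adj_sym that by metis
  qed (use finite_V in simp)
  have out_nb: "nb y = nb x" if "y \<in> V" "\<not> adj x y" for y
  proof (rule card_subset_eq[symmetric])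
    show "nb x \<subseteq> nb y"
    proof
      fix v assume "v \<in> nb x"
      then have "y \<in> nb v" using in_nb that by simp
      then show "v \<in> nb y" by (simp add: adj_commute)
    qed
    show "card (nb x) = card (nb y)" using regular \<open>x \<in> V\<close> that by simp
  qed simp
  show ?thesis
    using in_nb[of u] out_nb[of u] assms(3,4) by (cases "adj x u") (auto simp flip: mem_nb)
qed

section \<open>Edges that lie in triangles\<close>

definition heavy :: "'a \<Rightarrow> 'a set" where "heavy x = {y. adj x y \<and> codeg x y = b}"

lemma heavy_subset: "heavy x \<subseteq> nb x"
  by (auto simp: heavy_def)

lemma finite_heavy: "finite (heavy x)"
  using finite_subset[OF heavy_subset finite_nb] .

lemma triangle_codeg:
  assumes "adj x y" "adj y z" "adj x z"
  shows "codeg x y = b"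
proof -
  have "codeg x y \<noteq> 0" unfolding codeg_def using assms by auto
  then show ?thesis using codeg_cases[OF assms(1)] by simp
qed

text \<open>Codegrees of edges are \<open>0\<close> or \<open>b > 0\<close>, so a single triangle
  already makes an edge heavy.\<close>

lemma mem_heavy_iff: "y \<in> heavy x \<longleftrightarrow> adj x y \<and> (\<exists>z. adj x z \<and> adj y z)"
proof
  assume "y \<in> heavy x"
  then have "adj x y" "codeg x y \<noteq> 0" using b_pos by (auto simp: heavy_def)
  then show "adj x y \<and> (\<exists>z. adj x z \<and> adj y z)"
    unfolding codeg_def by auto
next
  assume "adj x y \<and> (\<exists>z. adj x z \<and> adj y z)"
  then show "y \<in> heavy x" using triangle_codeg unfolding heavy_def by blast
qed

text \<open>Edges in no triangle contribute \<open>0\<close>; counting triangles thus reduces to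
  counting heavy neighbours.\<close>

lemma sum_codeg: "(\<Sum>y\<in>nb x. codeg x y) = b * card (heavy x)"
proof -
  have "(\<Sum>y\<in>nb x. codeg x y) = (\<Sum>y\<in>heavy x. codeg x y)"
    using codeg_cases by (intro sum.mono_neutral_right) (fastforce simp: heavy_def)+
  then show ?thesis by (simp add: heavy_def)
qed

context
  fixes x y z
  assumes xy: "adj x y" and yz: "adj y z" and xz: "adj x z"
begin

lemma links_subset_heavy: "(nb x \<inter> nb y) \<union> (nb x \<inter> nb z) \<subseteq> heavy x"
  using xy xz adj_sym unfolding mem_heavy_iff subset_iff Un_iff Int_iff mem_nb by blast

text \<open>A common element of the two links would form a complete graph on four vertices with the
  triangle, so two sets of size \<open>b\<close> are disjoint.\<close>

lemma card_links: "card ((nb x \<inter> nb y) \<union> (nb x \<inter> nb z)) = 2 * b"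
proof -
  have "(nb x \<inter> nb y) \<inter> (nb x \<inter> nb z) = {}" using no_K4[OF xy yz xz] by auto
  then show ?thesis
    using triangle_codeg[OF xy yz xz] triangle_codeg[OF xz adj_sym[OF yz] xy]
    by (simp add: card_Un_disjoint codeg_def)
qed

lemma card_heavy_ge: "card (heavy x) \<ge> 2 * b"
  using card_mono[OF finite_heavy links_subset_heavy] card_links by simp

end

end

text \<open>In the case of equality the heavy neighbours of a vertex, which span its triangles,
  induce the complete bipartite graph with two parts of size \<open>b\<close>.\<close>

locale triangle_equality = book_equality +
  assumes card_heavy: "x \<in> V \<Longrightarrow> card (heavy x) = 2 * b"
begin

text \<open>The inclusion \<open>links_subset_heavy\<close> is now between sets of equal
  size.\<close>

lemma heavy_eq:
  assumes "adj x y" "adj y z" "adj x z"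
  shows "heavy x = (nb x \<inter> nb y) \<union> (nb x \<inter> nb z)"
proof (rule card_subset_eq[symmetric])
  show "card ((nb x \<inter> nb y) \<union> (nb x \<inter> nb z)) = card (heavy x)"
    using card_links[OF assms] card_heavy adj_V assms(1) by simp
qed (use finite_heavy links_subset_heavy[OF assms] in auto)

text \<open>A common neighbour of \<open>x\<close> and \<open>u\<close> is heavy at \<open>x\<close>
  and, by \<open>no_K4\<close>, not adjacent to \<open>y\<close>, so it is adjacent to
  \<open>z\<close>. Since both codegrees are \<open>b\<close>, the common neighbours of
  \<open>x\<close> and \<open>u\<close> are exactly those of \<open>x\<close> and \<open>z\<close>,
  and \<open>v\<close> is among them.\<close>

lemma links_complete:
  assumes t: "adj x y" "adj y z" "adj x z" and u: "adj x u" "adj y u" and v: "adj x v" "adj z v"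
  shows "adj u v"
proof -
  note sym = t[THEN adj_sym] u[THEN adj_sym]
  have "nb x \<inter> nb u = nb x \<inter> nb z"
  proof (rule card_subset_eq)
    show "nb x \<inter> nb u \<subseteq> nb x \<inter> nb z"
    proof
      fix w assume w: "w \<in> nb x \<inter> nb u"
      then have "w \<in> heavy x"
        using u(1) adj_sym unfolding mem_heavy_iff Int_iff mem_nb by blast
      moreover have "\<not> adj y w" using no_K4[of x y u w] t u w by auto
      ultimately show "w \<in> nb x \<inter> nb z" using heavy_eq[OF t] by auto
    qed
    have "card (nb x \<inter> nb u) = b"
      using triangle_codeg[of x u y] t u sym by (simp add: codeg_def)
    moreover have "card (nb x \<inter> nb z) = b"
      using triangle_codeg[of x z y] t sym by (simp add: codeg_def)
    ultimately show "card (nb x \<inter> nb u) = card (nb x \<inter> nb z)" by simp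
  qed simp
  then show ?thesis using v by auto
qed

text \<open>A neighbour \<open>v\<close> of \<open>x\<close> is dominated by the triangle
  \<open>a y z\<close>. If \<open>v\<close> is adjacent to \<open>y\<close> or \<open>z\<close>,
  then \<open>links_complete\<close> at that vertex makes it adjacent to \<open>a\<close>. Equal
  degrees give the converse.\<close>

lemma twins:
  assumes t: "adj x y" "adj y z" "adj x z" and a: "adj y a" "adj z a"
  shows "adj a v \<longleftrightarrow> adj x v"
proof -
  note sym = t[THEN adj_sym] a[THEN adj_sym]
  have "nb x = nb a"
  proof (rule card_subset_eq)
    show "nb x \<subseteq> nb a"
    proof
      fix v assume v: "v \<in> nb x"
      then have "v \<in> V" using nb_subset by blast
      then consider "adj y v" | "adj z v" | "adj a v"
        using dominated[of a y z v] t a sym by blast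
      then show "v \<in> nb a"
      proof cases
        case 1
        then show ?thesis using links_complete[of y z x a v] t a v sym by auto
      next
        case 2
        then show ?thesis using links_complete[of z y x a v] t a v sym by auto
      qed simp
    qed
    show "card (nb x) = card (nb a)"
      using regular adj_V[OF t(1)] adj_V[OF sym(4)] by simp
  qed simp
  then show ?thesis by (metis mem_nb)
qed

text \<open>Around a fixed triangle these sets become the parts \<open>V\<^sub>i\<close>, while the
  common neighbourhoods of its edges become the parts \<open>U\<^sub>i\<close>.\<close>

definition private_nb :: "'a \<Rightarrow> 'a \<Rightarrow> 'a \<Rightarrow> 'a set" where
  "private_nb x y z = {v. adj x v \<and> \<not> adj y v \<and> \<not> adj z v}"

lemma card_private_nb:
  assumes t: "adj x y" "adj y z" "adj x z"
  shows "card (private_nb x y z) = b"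
proof -
  let ?L = "(nb x \<inter> nb y) \<union> (nb x \<inter> nb z)"
  have "private_nb x y z = nb x - ?L" by (auto simp: private_nb_def)
  then have "card (private_nb x y z) = card (nb x) - card ?L"
    by (simp only:) (rule card_Diff_subset, auto)
  then show ?thesis using card_links[OF t] regular adj_V t(1) by simp
qed

text \<open>An edge inside the set would make its ends heavy at \<open>x\<close>, hence adjacent to
  \<open>y\<close> or \<open>z\<close> by \<open>heavy_eq\<close>.\<close>

lemma private_nb_independent:
  assumes t: "adj x y" "adj y z" "adj x z" and "u \<in> private_nb x y z" "v \<in> private_nb x y z"
  shows "\<not> adj u v"
proof
  assume "adj u v"
  then have "u \<in> heavy x" using assms(4,5) by (auto simp: mem_heavy_iff private_nb_def)
  then show False using assms(4) heavy_eq[OF t] by (auto simp: private_nb_def)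
qed

text \<open>A neighbour of \<open>u\<close> meets the triangle but is not private to
  \<open>x\<close>. If it were adjacent to \<open>x\<close> and \<open>y\<close>, it would be a twin
  of \<open>z\<close>, which is not adjacent to \<open>u\<close>; likewise with \<open>y\<close> and
  \<open>z\<close> exchanged. What remains is \<open>?R\<close>, of size at most
  \<open>3 * b\<close>, so \<open>nb u\<close> fills it.\<close>

lemma private_nb_complete:
  assumes t: "adj x y" "adj y z" "adj x z" and u: "u \<in> private_nb x y z"
    and v: "v \<in> private_nb y x z"
  shows "adj u v"
proof -
  let ?R = "(nb y \<inter> nb z) \<union> private_nb y x z \<union> private_nb z x y"
  note sym = t[THEN adj_sym]
  have finite_private: "finite (private_nb p q r)" for p q r
    using finite_nb[of p] by (rule rev_finite_subset) (auto simp: private_nb_def)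
  have "nb u = ?R"
  proof (rule card_seteq)
    show "finite ?R" using finite_private by simp
    show "nb u \<subseteq> ?R"
    proof
      fix w assume w: "w \<in> nb u"
      then have "w \<in> V" using nb_subset by blast
      then have "adj x w \<or> adj y w \<or> adj z w" using dominated[OF t] by blast
      moreover have "w \<notin> private_nb x y z" using private_nb_independent[OF t u] w by auto
      moreover have "adj w u" using w adj_sym by simp
      then have "\<not> (adj x w \<and> adj y w)" "\<not> (adj x w \<and> adj z w)"
        using twins[of z x y w u] twins[of y x z w u] t u sym by (auto simp: private_nb_def)
      ultimately show "w \<in> ?R" by (auto simp: private_nb_def)
    qed
    have "card ?R \<le> card (nb y \<inter> nb z) + card (private_nb y x z) + card (private_nb z x y)"
      using card_Un_le[of "nb y \<inter> nb z \<union> private_nb y x z" "private_nb z x y"]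
        card_Un_le[of "nb y \<inter> nb z" "private_nb y x z"] by linarith
    also have "\<dots> = 3 * b"
      using triangle_codeg[of y z x] card_private_nb[of y x z] card_private_nb[of z x y] t sym
      by (simp add: codeg_def)
    also have "\<dots> = card (nb u)"
      using regular[of u] adj_V[OF adj_sym[of x u]] u by (simp add: private_nb_def)
    finally show "card ?R \<le> card (nb u)" .
  qed
  then show ?thesis using v by auto
qed

text \<open>The label \<open>p v\<close> is the pair of side and index of a part of
  \<open>S\<^sub>b\<^sub>,\<^sub>n\<close>, and the exclusive or is the relation
  \<open>S_adj\<close> on such pairs.\<close>

lemma blowup_structure:
  assumes t: "adj x y" "adj y z" "adj x z"
  shows "\<exists>p :: 'a \<Rightarrow> bool \<times> nat. p ` V \<subseteq> UNIV \<times> {1..3} \<and>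
    (\<forall>q\<in>UNIV \<times> {1..3}. card {v \<in> V. p v = q} = b) \<and>
    (\<forall>u\<in>V. \<forall>v\<in>V. adj u v \<longleftrightarrow> (fst (p u) = fst (p v)) \<noteq> (snd (p u) = snd (p v)))"
proof -
  define p :: "'a \<Rightarrow> bool \<times> nat" where
    \<comment> \<open>The first three cases exclude each other by \<open>no_K4\<close>. On
      \<open>V\<close> the final default means adjacency to \<open>z\<close> alone, since
      \<open>dominated\<close> rules out having no neighbour in the triangle.\<close>
    "p v = (if adj y v \<and> adj z v then (False, 1) else if adj x v \<and> adj z v then (False, 2)
      else if adj x v \<and> adj y v then (False, 3) else if adj x v then (True, 1)
      else if adj y v then (True, 2) else (True, 3))" for v
  have t': "adj y x" "adj z y" "adj z x" using t adj_sym by blast+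
  have dom: "adj x v \<or> adj y v \<or> adj z v" if "v \<in> V" for v using dominated[OF t that] .
  have K4: "\<not> (adj x v \<and> adj y v \<and> adj z v)" for v using no_K4[OF t] .
  have inV: "v \<in> V" if "adj u v" for u v using that adj_V adj_sym by blast
  have p: "{v \<in> V. p v = (False, 1)} = nb y \<inter> nb z"
    "{v \<in> V. p v = (False, 2)} = nb x \<inter> nb z"
    "{v \<in> V. p v = (False, 3)} = nb x \<inter> nb y"
    "{v \<in> V. p v = (True, 1)} = private_nb x y z"
    "{v \<in> V. p v = (True, 2)} = private_nb y x z"
    "{v \<in> V. p v = (True, 3)} = private_nb z x y"
    using dom K4 inV by (auto simp: p_def private_nb_def)
  have index: "q \<in> UNIV \<times> {1..3} \<longleftrightarrow>
      q \<in> {(False, 1), (False, 2), (False, 3), (True, 1), (True, 2), (True, 3::nat)}" for q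
    by (cases q) auto
  have "card {v \<in> V. p v = q} = b" if "q \<in> UNIV \<times> {1..3}" for q
    using that t t' triangle_codeg[of x y z] triangle_codeg[of x z y] triangle_codeg[of y z x]
      card_private_nb[of x y z] card_private_nb[of y x z] card_private_nb[of z x y]
    unfolding index by (auto simp: p codeg_def simp del: One_nat_def)
  moreover have "adj u v \<longleftrightarrow> (fst (p u) = fst (p v)) \<noteq> (snd (p u) = snd (p v))"
    if "u \<in> V" "v \<in> V" for u v
  proof -
    have tw: "adj y w \<and> adj z w \<Longrightarrow> adj w w' = adj x w'"
      "adj x w \<and> adj z w \<Longrightarrow> adj w w' = adj y w'"
      "adj x w \<and> adj y w \<Longrightarrow> adj w w' = adj z w'" for w w'
      using twins[of x y z w w'] twins[of y x z w w'] twins[of z x y w w'] t t' by auto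
    have pr: "\<lbrakk>u \<in> private_nb x y z; v \<in> private_nb x y z\<rbrakk> \<Longrightarrow> \<not> adj u v"
      "\<lbrakk>u \<in> private_nb y x z; v \<in> private_nb y x z\<rbrakk> \<Longrightarrow> \<not> adj u v"
      "\<lbrakk>u \<in> private_nb z x y; v \<in> private_nb z x y\<rbrakk> \<Longrightarrow> \<not> adj u v"
      "\<lbrakk>u \<in> private_nb x y z; v \<in> private_nb y x z\<rbrakk> \<Longrightarrow> adj u v"
      "\<lbrakk>u \<in> private_nb x y z; v \<in> private_nb z x y\<rbrakk> \<Longrightarrow> adj u v"
      "\<lbrakk>u \<in> private_nb y x z; v \<in> private_nb z x y\<rbrakk> \<Longrightarrow> adj u v"
      for u v
      using private_nb_independent[of x y z u v] private_nb_independent[of y x z u v]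
        private_nb_independent[of z x y u v] private_nb_complete[of x y z u v]
        private_nb_complete[of x z y u v] private_nb_complete[of y z x u v] t t'
      by (auto simp: private_nb_def)
    have U: "p u = (False, 1) \<Longrightarrow> adj u w = adj x w"
      "p u = (False, 2) \<Longrightarrow> adj u w = adj y w"
      "p u = (False, 3) \<Longrightarrow> adj u w = adj z w" if "u \<in> V" for u w
      using tw[of u w] by (auto simp: p_def split: if_splits)
    have nbs: "adj x v \<longleftrightarrow> p v = (False, 2) \<or> p v = (False, 3) \<or> p v = (True, 1)"
      "adj y v \<longleftrightarrow> p v = (False, 1) \<or> p v = (False, 3) \<or> p v = (True, 2)"
      "adj z v \<longleftrightarrow> p v = (False, 1) \<or> p v = (False, 2) \<or> p v = (True, 3)" if "v \<in> V" for v
      using dom[OF that] K4[of v] by (auto simp: p_def)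
    have priv: "w \<in> private_nb x y z \<longleftrightarrow> p w = (True, 1)"
      "w \<in> private_nb y x z \<longleftrightarrow> p w = (True, 2)"
      "w \<in> private_nb z x y \<longleftrightarrow> p w = (True, 3)" if "w \<in> V" for w
      using p that by blast+
    have cls: "p w \<in> {(False, 1), (False, 2), (False, 3), (True, 1), (True, 2), (True, 3)}" for w
      by (simp add: p_def)
    \<comment> \<open>A vertex of some \<open>U\<^sub>i\<close> copies the adjacencies of its twin
      in the triangle, which settles it against every \<open>v\<close>. Only pairs of private
      neighbours are left for \<open>from_V\<close>.\<close>
    have from_U: "adj u v \<longleftrightarrow> (fst (p u) = fst (p v)) \<noteq> (snd (p u) = snd (p v))"
      if "u \<in> V" "v \<in> V" "\<not> fst (p u)" for u v
    proof -
      have "p u \<in> {(False, 1), (False, 2), (False, 3)}" using cls[of u] that(3) by auto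
      then show ?thesis
        using cls[of v] U[OF that(1), of v] nbs[OF that(2)] by (elim insertE) simp_all
    qed
    have from_V: "adj u v \<longleftrightarrow> (fst (p u) = fst (p v)) \<noteq> (snd (p u) = snd (p v))"
      if "u \<in> V" "v \<in> V" "fst (p u)" "fst (p v)"
    proof -
      have "p u \<in> {(True, 1), (True, 2), (True, 3)}" "p v \<in> {(True, 1), (True, 2), (True, 3)}"
        using cls[of u] cls[of v] that(3,4) by auto
      then show ?thesis
        using pr[of u v] pr(4-6)[of v u] adj_sym[of v u] unfolding priv[OF that(1)] priv[OF that(2)]
        by (elim insertE) simp_all
    qed
    show ?thesis
      using from_U[OF that] from_U[OF that(2,1)] from_V[OF that] adj_commute[of u v] by metis
  qed
  moreover have "p ` V \<subseteq> UNIV \<times> {1..3}" by (auto simp: p_def)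
  ultimately show ?thesis by blast
qed

end

section \<open>The extremal graphs\<close>

text \<open>Bijections on the fibres of \<open>p\<close> are glued together; this numbers the
  vertices within each part for both target graphs.\<close>

lemma labelled_enumeration:
  assumes "finite V" and "p ` V \<subseteq> I" and "\<And>q. q \<in> I \<Longrightarrow> card {v \<in> V. p v = q} = m q"
  shows "\<exists>f :: 'a \<Rightarrow> nat. bij_betw (\<lambda>v. (p v, f v)) V (SIGMA q:I. {..<m q})"
proof -
  have "\<exists>g. bij_betw g {v \<in> V. p v = q} {..<m q}" if "q \<in> I" for q
    using assms(1) assms(3)[OF that] ex_bij_betw_finite_nat[of "{v \<in> V. p v = q}"]
    by (auto simp: lessThan_atLeast0)
  then obtain g where g: "\<And>q. q \<in> I \<Longrightarrow> bij_betw (g q) {v \<in> V. p v = q} {..<m q}"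
    by metis
  have "bij_betw (\<lambda>v. (p v, g (p v) v)) V (SIGMA q:I. {..<m q})"
    unfolding bij_betw_def
  proof
    show "inj_on (\<lambda>v. (p v, g (p v) v)) V"
    proof (rule inj_onI)
      fix u v assume uv: "u \<in> V" "v \<in> V" "(p u, g (p u) u) = (p v, g (p v) v)"
      then have "p u \<in> I" using assms(2) by blast
      from bij_betw_imp_inj_on[OF g[OF this]] uv show "u = v" by (auto dest: inj_onD)
    qed
    show "(\<lambda>v. (p v, g (p v) v)) ` V = (SIGMA q:I. {..<m q})"
    proof (intro equalityI subsetI)
      fix w assume "w \<in> (\<lambda>v. (p v, g (p v) v)) ` V"
      then obtain v where v: "v \<in> V" "w = (p v, g (p v) v)" by blast
      then have "p v \<in> I" using assms(2) by blast
      with bij_betwE[OF g[OF this]] v show "w \<in> (SIGMA q:I. {..<m q})" by auto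
    next
      fix w assume "w \<in> (SIGMA q:I. {..<m q})"
      then obtain q k where w: "w = (q, k)" "q \<in> I" "k < m q" by blast
      then have "k \<in> g q ` {v \<in> V. p v = q}" using g[OF \<open>q \<in> I\<close>] by (auto simp: bij_betw_def)
      then show "w \<in> (\<lambda>v. (p v, g (p v) v)) ` V" using w by auto
    qed
  qed
  then show ?thesis by (rule exI[where x = "\<lambda>v. g (p v) v"])
qed

text \<open>Membership in \<open>X\<close> serves as the boolean side. As \<open>n\<close> is even,
  rounding down and up both give \<open>m\<close>.\<close>

lemma bipartite_iso:
  assumes "finite (verts G)" and "X \<subseteq> verts G"
    and "card X = m" and "card (verts G - X) = m" and n: "n = 2 * m"
    and adj: "\<And>u v. \<lbrakk>u \<in> verts G; v \<in> verts G\<rbrakk> \<Longrightarrow>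
      {u, v} \<in> edges G \<longleftrightarrow> ((u \<in> X) \<noteq> (v \<in> X))"
  shows "graph_iso G (balanced_complete_bipartite n)"
proof -
  have m: "n div 2 = m" "Suc n div 2 = m" using n by auto
  have fib: "card {v \<in> verts G. (v \<in> X) = q} = m" for q
  proof (cases q)
    case True
    then have "{v \<in> verts G. (v \<in> X) = q} = X" using assms(2) by auto
    then show ?thesis using assms(3) by simp
  next
    case False
    then have "{v \<in> verts G. (v \<in> X) = q} = verts G - X" by auto
    then show ?thesis using assms(4) by simp
  qed
  obtain f :: "'a \<Rightarrow> nat" where
    f: "bij_betw (\<lambda>v. (v \<in> X, f v)) (verts G) (SIGMA q:UNIV. {..<m})"
    using labelled_enumeration[OF assms(1), of "\<lambda>v. v \<in> X" UNIV "\<lambda>_. m"] fib by auto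
  have vertsB: "verts (balanced_complete_bipartite n) = (SIGMA q:UNIV. {..<m})"
    by (auto simp: balanced_complete_bipartite_def Let_def m)
  have edgesB: "{(s, i), (t, j)} \<in> edges (balanced_complete_bipartite n) \<longleftrightarrow> s \<noteq> t"
    if "i < m" "j < m" for s t i j
    using that by (cases s; cases t)
      (auto simp: balanced_complete_bipartite_def Let_def m doubleton_eq_iff)
  have "f v < m" if "v \<in> verts G" for v using bij_betwE[OF f] that by auto
  then show ?thesis
    unfolding graph_iso_def using f adj by (auto simp: vertsB edgesB)
qed

text \<open>The third parts have size \<open>(2 * b) div 2\<close> or
  \<open>(2 * b + 1) div 2\<close>, which is \<open>b\<close> either way.\<close>

lemma S_part_size_balanced: "S_part_size b (6 * b) s i = b"
  by (simp add: S_part_size_def)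

lemma verts_S_graph: "verts (S_graph b (6 * b)) = {(s, i, k). i \<in> {1..3} \<and> k < b}"
  by (simp add: S_graph_def Let_def S_part_size_balanced)

lemma edges_S_graph:
  assumes "x \<in> verts (S_graph b n)" and "y \<in> verts (S_graph b n)"
  shows "{x, y} \<in> edges (S_graph b n) \<longleftrightarrow> S_adj x y"
proof -
  have "S_adj u v \<longleftrightarrow> S_adj v u" for u v by (auto simp: S_adj_def split: prod.splits)
  moreover have "edges (S_graph b n) = {{u, v} | u v. u \<in> verts (S_graph b n) \<and>
      v \<in> verts (S_graph b n) \<and> S_adj u v}"
    by (simp add: S_graph_def Let_def)
  ultimately show ?thesis using assms by (simp add: doubleton_eq_iff del: split_paired_Ex) blast
qed

lemma S_graph_iso:
  fixes p :: "'a \<Rightarrow> bool \<times> nat"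
  assumes "finite (verts G)" and "p ` verts G \<subseteq> UNIV \<times> {1..3}"
    and "\<And>q. q \<in> UNIV \<times> {1..3} \<Longrightarrow> card {v \<in> verts G. p v = q} = b"
    and adj: "\<And>u v. \<lbrakk>u \<in> verts G; v \<in> verts G\<rbrakk> \<Longrightarrow>
      {u, v} \<in> edges G \<longleftrightarrow> (fst (p u) = fst (p v)) \<noteq> (snd (p u) = snd (p v))"
  shows "graph_iso G (S_graph b (6 * b))"
proof -
  obtain f :: "'a \<Rightarrow> nat" where
    f: "bij_betw (\<lambda>v. (p v, f v)) (verts G) (SIGMA q:UNIV \<times> {1..3}. {..<b})"
    using labelled_enumeration[OF assms(1-3)] by blast
  \<comment> \<open>The enumeration produces \<open>((s, i), k)\<close>; vertices of
    \<open>S_graph\<close> are bracketed the other way.\<close>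
  have "bij_betw (\<lambda>((s, i), k). (s, i, k)) (SIGMA q:UNIV \<times> {1..3}. {..<b})
      (verts (S_graph b (6 * b)))"
    by (rule bij_betw_byWitness[where f' = "\<lambda>(s, i, k). ((s, i), k)"]) (auto simp: verts_S_graph)
  from bij_betw_trans[OF f this]
  have g: "bij_betw (\<lambda>v. (fst (p v), snd (p v), f v)) (verts G) (verts (S_graph b (6 * b)))"
    by (simp add: o_def case_prod_unfold)
  then have "(fst (p v), snd (p v), f v) \<in> verts (S_graph b (6 * b))" if "v \<in> verts G" for v
    using bij_betwE that by blast
  then show ?thesis
    unfolding graph_iso_def using g adj
    by (intro exI[of _ "\<lambda>v. (fst (p v), snd (p v), f v)"] conjI ballI)
      (simp_all add: edges_S_graph S_adj_def, blast)
qed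

section \<open>Triangle counts under isomorphism and in \<open>S_graph\<close>\<close>

lemma graph_iso_card_triangles:
  assumes "graph_iso G H"
  shows "card (triangles G) = card (triangles H)"
proof -
  obtain f where f: "bij_betw f (verts G) (verts H)"
    and e: "\<And>u v. \<lbrakk>u \<in> verts G; v \<in> verts G\<rbrakk> \<Longrightarrow> {u, v} \<in> edges G \<longleftrightarrow> {f u, f v} \<in> edges H"
    using assms unfolding graph_iso_def by blast
  have inj: "inj_on f (verts G)" using f by (rule bij_betw_imp_inj_on)
  have tri: "f ` T \<in> triangles H \<longleftrightarrow> T \<in> triangles G" if T: "T \<subseteq> verts G" for T
  proof -
    have "f ` T \<subseteq> verts H" using T f by (auto simp: bij_betw_def)
    moreover have "card (f ` T) = card T" using inj_on_subset[OF inj T] by (rule card_image)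
    moreover have "(\<forall>u\<in>f ` T. \<forall>v\<in>f ` T. u \<noteq> v \<longrightarrow> {u, v} \<in> edges H) \<longleftrightarrow>
        (\<forall>u\<in>T. \<forall>v\<in>T. u \<noteq> v \<longrightarrow> {u, v} \<in> edges G)"
      using T e inj_on_eq_iff[OF inj] by (simp add: subset_iff)
    ultimately show ?thesis using T by (simp add: triangles_def)
  qed
  have "bij_betw ((`) f) (triangles G) (triangles H)"
  proof (rule bij_betw_imageI)
    show "inj_on ((`) f) (triangles G)"
      by (rule inj_on_subset[OF inj_on_image_Pow[OF inj]]) (auto simp: triangles_def)
    show "(`) f ` triangles G = triangles H"
    proof (intro equalityI subsetI)
      fix T assume "T \<in> (`) f ` triangles G"
      then obtain T' where "T' \<in> triangles G" "T = f ` T'" by blast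
      moreover from this(1) have "T' \<subseteq> verts G" by (simp add: triangles_def)
      ultimately show "T \<in> triangles H" using tri by simp
    next
      fix T assume T: "T \<in> triangles H"
      then have "T \<subseteq> f ` verts G" using f by (auto simp: triangles_def bij_betw_def)
      then obtain T' where "T' \<subseteq> verts G" "T = f ` T'" by (auto simp: subset_image_iff)
      then show "T \<in> (`) f ` triangles G" using T tri by blast
    qed
  qed
  then show ?thesis by (rule bij_betw_same_card)
qed

text \<open>Adjacent vertices on different sides share their index, while those on one side do not.
  So a triangle stays on one side and takes one vertex from each of its three parts.\<close>

lemma card_triangles_S_graph: "card (triangles (S_graph b (6 * b))) = 2 * b ^ 3"
proof -
  let ?S = "S_graph b (6 * b)"
  let ?I = "(UNIV :: bool set) \<times> {..<b} \<times> {..<b} \<times> {..<b}"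
  define h :: "bool \<times> nat \<times> nat \<times> nat \<Rightarrow> (bool \<times> nat \<times> nat) set" where
    "h = (\<lambda>(s, k, l, m). {(s, 1, k), (s, 2, l), (s, 3, m)})"
  have "bij_betw h ?I (triangles ?S)"
  proof (rule bij_betw_imageI)
    show "inj_on h ?I"
    proof (rule inj_onI)
      fix p q assume eq: "h p = h q"
      obtain s k l m where p: "p = (s, k, l, m)" by (cases p)
      \<comment> \<open>The indices 1, 2, 3 tell the elements apart, so this inclusion already
        determines all coordinates.\<close>
      have "{(s, 1, k), (s, 2, l), (s, 3, m)} \<subseteq> h q" unfolding eq[symmetric] by (simp add: p h_def)
      then show "p = q" unfolding p by (cases q) (simp add: h_def)
    qed
    show "h ` ?I = triangles ?S"
    proof (intro equalityI subsetI)
      fix T assume "T \<in> h ` ?I"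
      then obtain s k l m where T: "T = {(s, 1, k), (s, 2, l), (s, 3, m)}"
        and "k < b" "l < b" "m < b" by (auto simp: h_def)
      then have sub: "T \<subseteq> verts ?S" by (auto simp: verts_S_graph)
      moreover have "card T = 3" unfolding T by simp
      moreover have "\<forall>u\<in>T. \<forall>v\<in>T. u \<noteq> v \<longrightarrow> S_adj u v" unfolding T by (simp add: S_adj_def)
      then have "\<forall>u\<in>T. \<forall>v\<in>T. u \<noteq> v \<longrightarrow> {u, v} \<in> edges ?S"
        using edges_S_graph sub by (meson subsetD)
      ultimately show "T \<in> triangles ?S" by (simp add: triangles_def)
    next
      fix T assume T: "T \<in> triangles ?S"
      then have sub: "T \<subseteq> verts ?S" and "card T = 3"
        and "\<forall>u\<in>T. \<forall>v\<in>T. u \<noteq> v \<longrightarrow> {u, v} \<in> edges ?S"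
        by (simp_all add: triangles_def)
      then have adj: "S_adj u v" if "u \<in> T" "v \<in> T" "u \<noteq> v" for u v
        using edges_S_graph that by (meson subsetD)
      obtain x y z where T_eq: "T = {x, y, z}" "x \<noteq> y" "x \<noteq> z" "y \<noteq> z"
        using \<open>card T = 3\<close> by (metis card_3_iff)
      obtain s i k t j l r a m where "x = (s, i, k)" "y = (t, j, l)" "z = (r, a, m)"
        by (cases x, cases y, cases z)
      note xyz = T_eq[unfolded this]
      have "S_adj (s, i, k) (t, j, l)" "S_adj (s, i, k) (r, a, m)" "S_adj (t, j, l) (r, a, m)"
        using adj xyz by auto
      then have side: "t = s" "r = s" and distinct: "i \<noteq> j" "i \<noteq> a" "j \<noteq> a"
        by (auto simp: S_adj_def)
      have "{i, j, a} \<subseteq> {1..3}" using sub by (auto simp: verts_S_graph xyz)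
      then have "{i, j, a} = {1..3}"
        using distinct by (intro card_subset_eq) simp_all
      \<comment> \<open>The vertices \<open>x\<close>, \<open>y\<close>, \<open>z\<close> come in
        arbitrary order; they are renamed by index to reach the form of \<open>h\<close>.\<close>
      then have "1 \<in> {i, j, a}" "2 \<in> {i, j, a}" "3 \<in> {i, j, a}" by simp_all
      then obtain k' l' m' where sub': "{(s, 1, k'), (s, 2, l'), (s, 3, m')} \<subseteq> T"
        unfolding xyz side by blast
      then have "{(s, 1, k'), (s, 2, l'), (s, 3, m')} = T"
        using \<open>card T = 3\<close> by (intro card_subset_eq) (simp_all add: xyz)
      moreover have "k' < b" "l' < b" "m' < b"
        using sub sub' by (auto simp: verts_S_graph)
      ultimately show "T \<in> h ` ?I"
        by (intro image_eqI[of _ _ "(s, k', l', m')"]) (simp_all add: h_def)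
    qed
  qed
  then have "card (triangles ?S) = card ?I" by (metis bij_betw_same_card)
  then show ?thesis by (simp add: card_cartesian_product card_UNIV_bool power3_eq_cube)
qed

section \<open>Simple graphs as adjacency relations\<close>

locale ugraph_adjacency =
  fixes G :: "'a ugraph"
  assumes simple: "simple_graph G"
begin

definition adj :: "'a \<Rightarrow> 'a \<Rightarrow> bool" where "adj u v \<longleftrightarrow> {u, v} \<in> edges G"

lemma finite_verts: "finite (verts G)"
  using simple by (simp add: simple_graph_def)

lemma edge_card: "e \<in> edges G \<Longrightarrow> e \<subseteq> verts G \<and> card e = 2"
  using simple by (simp add: simple_graph_def)

sublocale finite_adjacency "verts G" adj
proof
  show "finite (verts G)" by (rule finite_verts)
  show "x \<in> verts G" if "adj x y" for x y using edge_card that by (auto simp: adj_def)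
  show "adj y x" if "adj x y" for x y using that by (simp add: adj_def insert_commute)
  show "\<not> adj x x" for x using edge_card[of "{x}"] by (auto simp: adj_def)
qed

lemma finite_edges: "finite (edges G)"
  by (rule finite_subset[of _ "Pow (verts G)"]) (use edge_card in blast, use finite_verts in simp)

lemma finite_triangles: "finite (triangles G)"
  by (rule finite_subset[of _ "Pow (verts G)"]) (use finite_verts in \<open>auto simp: triangles_def\<close>)

section \<open>Double counting of edges and triangles\<close>

lemma edges_at: "bij_betw (\<lambda>y. {x, y}) (nb x) {e \<in> edges G. x \<in> e}"
proof (rule bij_betw_imageI)
  show "inj_on (\<lambda>y. {x, y}) (nb x)" by (auto simp: inj_on_def doubleton_eq_iff)
  show "(\<lambda>y. {x, y}) ` nb x = {e \<in> edges G. x \<in> e}"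
  proof (intro equalityI subsetI)
    fix e assume e: "e \<in> {e \<in> edges G. x \<in> e}"
    then have "card e = 2" using edge_card by blast
    then obtain u v where "e = {u, v}" by (metis card_2_iff)
    moreover have "x \<in> e" using e by simp
    ultimately obtain y where "e = {x, y}" by (metis insert_commute insertE singletonD)
    then show "e \<in> (\<lambda>y. {x, y}) ` nb x" using e by (auto simp: adj_def)
  qed (auto simp: adj_def)
qed

text \<open>Weighted handshake: every edge is seen from both ends. Weight 1 gives the degree sum,
  and the number of triangles on an edge gives the triangle count.\<close>

lemma sum_nb_edges:
  fixes f :: "'a set \<Rightarrow> nat"
  shows "(\<Sum>x\<in>verts G. \<Sum>y\<in>nb x. f {x, y}) = 2 * (\<Sum>e\<in>edges G. f e)"
proof -
  have "(\<Sum>x\<in>verts G. \<Sum>y\<in>nb x. f {x, y}) = (\<Sum>x\<in>verts G. \<Sum>e | e \<in> edges G \<and> x \<in> e. f e)"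
    by (intro sum.cong refl sum.reindex_bij_betw[OF edges_at])
  also have "\<dots> = (\<Sum>e\<in>edges G. \<Sum>x | x \<in> verts G \<and> x \<in> e. f e)"
    by (rule sum.swap_restrict[OF finite_verts finite_edges])
  also have "\<dots> = (\<Sum>e\<in>edges G. 2 * f e)"
  proof (intro sum.cong refl)
    fix e assume "e \<in> edges G"
    then have "{x. x \<in> verts G \<and> x \<in> e} = e" "card e = 2" using edge_card by auto
    then show "(\<Sum>x | x \<in> verts G \<and> x \<in> e. f e) = 2 * f e" by simp
  qed
  finally show ?thesis by (simp add: sum_distrib_left)
qed

lemma sum_degrees: "(\<Sum>x\<in>verts G. card (nb x)) = 2 * card (edges G)"
  using sum_nb_edges[of "\<lambda>_. 1"] by simp

lemma triangle_iff:
  assumes "adj u v"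
  shows "T \<in> triangles G \<and> {u, v} \<subseteq> T \<longleftrightarrow> (\<exists>z\<in>nb u \<inter> nb v. T = {u, v, z})"
proof
  assume T: "T \<in> triangles G \<and> {u, v} \<subseteq> T"
  have "u \<noteq> v" using assms adj_irrefl by blast
  have "card (T - {u, v}) = 1"
    using T \<open>u \<noteq> v\<close> by (subst card_Diff_subset) (auto simp: triangles_def)
  then obtain z where z: "T - {u, v} = {z}" by (auto simp: card_1_singleton_iff)
  then have "T = {u, v, z}" "z \<noteq> u" "z \<noteq> v" using T by auto
  then show "\<exists>z\<in>nb u \<inter> nb v. T = {u, v, z}" using T by (auto simp: triangles_def adj_def)
next
  assume "\<exists>z\<in>nb u \<inter> nb v. T = {u, v, z}"
  then obtain z where z: "adj u z" "adj v z" "T = {u, v, z}" by auto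
  note sym = assms[THEN adj_sym] z(1,2)[THEN adj_sym]
  have "u \<noteq> v" "u \<noteq> z" "v \<noteq> z" using z assms adj_irrefl by blast+
  then have "card T = 3" unfolding z(3) by simp
  moreover have "T \<subseteq> verts G" using adj_V[OF assms] sym(1,2)[THEN adj_V] adj_V[OF sym(2)] z(3)
    by simp
  moreover have "\<forall>p\<in>T. \<forall>q\<in>T. p \<noteq> q \<longrightarrow> {p, q} \<in> edges G"
    using z(1,2) assms sym unfolding z(3) adj_def by simp
  ultimately show "T \<in> triangles G \<and> {u, v} \<subseteq> T"
    using z(3) by (simp add: triangles_def)
qed

lemma card_triangles_edge:
  assumes "adj u v"
  shows "card {T \<in> triangles G. {u, v} \<subseteq> T} = codeg u v"
proof -
  have "{T \<in> triangles G. {u, v} \<subseteq> T} = (\<lambda>z. {u, v, z}) ` (nb u \<inter> nb v)"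
    by (simp only: triangle_iff[OF assms] image_def)
  moreover have "inj_on (\<lambda>z. {u, v, z}) (nb u \<inter> nb v)"
  proof (rule inj_onI)
    fix z z' assume "z \<in> nb u \<inter> nb v" and eq: "{u, v, z} = {u, v, z'}"
    then have "z \<noteq> u" "z \<noteq> v" using adj_irrefl by auto
    moreover have "z \<in> {u, v, z'}" unfolding eq[symmetric] by simp
    ultimately show "z = z'" by simp
  qed
  ultimately show ?thesis by (simp add: codeg_def card_image)
qed

text \<open>The factor 6 arises from three edges per triangle, each seen from both ends.\<close>

lemma sum_codeg_triangles:
  "(\<Sum>x\<in>verts G. \<Sum>y\<in>nb x. codeg x y) = 6 * card (triangles G)"
proof -
  let ?f = "\<lambda>e. card {T \<in> triangles G. e \<subseteq> T}"
  have "(\<Sum>e\<in>edges G. ?f e) = (\<Sum>T\<in>triangles G. 3)"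
  proof (rule sum_multicount_gen[OF finite_edges finite_triangles], intro ballI)
    fix T assume T: "T \<in> triangles G"
    then have "finite T" "card T = 3" using finite_verts
      by (auto simp: triangles_def intro: finite_subset)
    have "{e \<in> edges G. e \<subseteq> T} = {e. e \<subseteq> T \<and> card e = 2}"
    proof (intro equalityI subsetI)
      fix e assume e: "e \<in> {e. e \<subseteq> T \<and> card e = 2}"
      then obtain p q where "e = {p, q}" "p \<noteq> q" by (auto simp: card_2_iff)
      then show "e \<in> {e \<in> edges G. e \<subseteq> T}" using T e by (simp add: triangles_def)
    qed (use edge_card in blast)
    then show "card {e \<in> edges G. e \<subseteq> T} = 3"
      using n_subsets[OF \<open>finite T\<close>, of 2] \<open>card T = 3\<close> by (simp add: choose_two)
  qed
  moreover have "(\<Sum>x\<in>verts G. \<Sum>y\<in>nb x. codeg x y) = (\<Sum>x\<in>verts G. \<Sum>y\<in>nb x. ?f {x, y})"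
    by (intro sum.cong refl card_triangles_edge[symmetric]) simp
  ultimately show ?thesis using sum_nb_edges[of ?f] by simp
qed

lemma codeg_le_book_number:
  assumes "adj u v"
  shows "codeg u v \<le> book_number G"
  unfolding book_number_def card_triangles_edge[OF assms, symmetric]
  using assms[unfolded adj_def] finite_edges
  by (intro Max_ge finite.insertI finite_imageI insertI2 imageI)

end

theorem theorem1p3:
  fixes n b :: nat and G :: "'a ugraph"
  assumes "n > 0" and "6 dvd n" and "b = n div 6"
    and "simple_graph G" and "card (verts G) = n"
    and "real (card (edges G)) \<ge> (real n)\<^sup>2 / 4"
    and "book_number G \<le> b"
    and "\<not> graph_iso G (balanced_complete_bipartite n)"
  shows "card (triangles G) \<ge> b\<^sup>2 * (n - 4 * b) \<and>
         (card (triangles G) = b\<^sup>2 * (n - 4 * b) \<longleftrightarrow> graph_iso G (S_graph b n))"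
proof -
  interpret ugraph_adjacency G by standard (rule assms(4))
  have n: "n = 6 * b" using assms(2,3) by simp
  have "b > 0" using n assms(1) by simp
  have card_V: "card (verts G) = 6 * b" using assms(5) n by simp
  have book: "codeg x y \<le> b" if "adj x y" for x y
    using codeg_le_book_number[OF that] assms(7) by simp
  \<comment> \<open>Here \<open>n\<^sup>2 / 4 = 9 * b\<^sup>2\<close>, and doubling gives the degree
    sum.\<close>
  have "real (9 * b\<^sup>2) \<le> real (card (edges G))"
    using assms(6) by (simp add: n power_mult_distrib)
  then have degsum: "18 * b\<^sup>2 \<le> (\<Sum>x\<in>verts G. card (nb x))"
    unfolding sum_degrees of_nat_le_iff by simp
  note ext = extremal_book[OF card_V \<open>b > 0\<close> book degsum]
  interpret book_equality "verts G" adj b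
    by unfold_locales (use \<open>b > 0\<close> card_V ext in blast)+
  \<comment> \<open>The exclusion of the balanced complete bipartite graph enters here: a vertex in
    no triangle has an independent neighbourhood.\<close>
  have triangle_at: "\<exists>y z. adj x y \<and> adj y z \<and> adj x z" if "x \<in> verts G" for x
  proof (rule ccontr)
    assume no: "\<not> ?thesis"
    have "graph_iso G (balanced_complete_bipartite n)"
    proof (rule bipartite_iso[of G "nb x"])
      show "card (verts G - nb x) = 3 * b"
        using card_Diff_subset[OF finite_nb nb_subset] regular[OF that] card_V by simp
      show "{u, v} \<in> edges G \<longleftrightarrow> ((u \<in> nb x) \<noteq> (v \<in> nb x))"
        if "u \<in> verts G" "v \<in> verts G" for u v
        unfolding adj_def[symmetric] mem_nb
        by (rule independent_nb_bipartite[OF \<open>x \<in> verts G\<close> _ that]) (use no in blast)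
    qed (use finite_verts nb_subset regular[OF that] n in auto)
    then show False using assms(8) by contradiction
  qed
  have heavy_ge: "card (heavy x) \<ge> 2 * b" if "x \<in> verts G" for x
    using triangle_at[OF that] card_heavy_ge by blast
  have count: "6 * card (triangles G) = b * (\<Sum>x\<in>verts G. card (heavy x))"
    using sum_codeg_triangles by (simp add: sum_codeg sum_distrib_left)
  have const: "(\<Sum>x\<in>verts G. 2 * b) = 12 * b\<^sup>2"
    by (simp add: card_V power2_eq_square)
  have bound: "b\<^sup>2 * (n - 4 * b) = 2 * b ^ 3"
    by (simp add: n power2_eq_square power3_eq_cube)
  have "12 * b\<^sup>2 \<le> (\<Sum>x\<in>verts G. card (heavy x))"
    unfolding const[symmetric] by (intro sum_mono heavy_ge)
  then have "b * (12 * b\<^sup>2) \<le> 6 * card (triangles G)"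
    unfolding count by (rule mult_le_mono2)
  then have lower: "2 * b ^ 3 \<le> card (triangles G)"
    by (simp add: power2_eq_square power3_eq_cube)
  have "graph_iso G (S_graph b n)" if eq: "card (triangles G) = 2 * b ^ 3"
  proof -
    have "b * (\<Sum>x\<in>verts G. card (heavy x)) = b * (12 * b\<^sup>2)"
      unfolding count[symmetric] eq by (simp add: power2_eq_square power3_eq_cube)
    \<comment> \<open>Each term on the right is at least \<open>2 * b\<close>, so equal sums force
      equality at every vertex, as \<open>triangle_equality\<close> requires.\<close>
    then have sum_eq: "(\<Sum>x\<in>verts G. 2 * b) = (\<Sum>x\<in>verts G. card (heavy x))"
      unfolding const using \<open>b > 0\<close> by simp
    interpret triangle_equality "verts G" adj b
    proof
      show "card (heavy x) = 2 * b" if "x \<in> verts G" for x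
        using sum_mono_inv[OF sum_eq heavy_ge that finite_verts] by simp
    qed
    obtain x where "x \<in> verts G" using card_V \<open>b > 0\<close> by fastforce
    then obtain y z where "adj x y" "adj y z" "adj x z" using triangle_at by blast
    from blowup_structure[OF this] show ?thesis
      unfolding n adj_def using S_graph_iso[OF finite_verts] by blast
  qed
  moreover have "card (triangles G) = 2 * b ^ 3" if "graph_iso G (S_graph b n)"
    using graph_iso_card_triangles[OF that] card_triangles_S_graph n by simp
  ultimately show ?thesis unfolding bound using lower by blast
qed

end
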